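(* Let $\alpha\in\bigwedge^n\mathbf R^{2n}$ and let $\alpha_1,\alpha_2\in\bigwedge^n\mathbf R^{4n}$ be the isomorphic copies of $\alpha$ under the natural identifications $\mathbf R^{2n}\times\{0\}\cong\mathbf R^{2n}\cong\{0\}\times\mathbf R^{2n}$. Then the comass of $\alpha_1\wedge\alpha_2\in\bigwedge^{2n}\mathbf R^{4n}$ is bounded from below by \[ \|\alpha_1\wedge\alpha_2\|\ \ge\ \frac{|\alpha^2|}{2^n}, \] where $\alpha^2=\alpha\wedge\alpha\in\bigwedge^{2n}\mathbf R^{2n}$ is a top form.
   Context: $\bigwedge^m\mathbf R^N$ is the space of alternating real $m$-linear forms on $\mathbf R^N$. The copies $\alpha_1,\alpha_2$ are the pullbacks of $\alpha$ under the two projections $\mathbf R^{4n}=\mathbf R^{2n}\times\mathbf R^{2n}\to\mathbf R^{2n}$ onto the first and second factor. The wedge product is normalized by $\alpha\wedge\beta=\frac{(k+l)!}{k!\,l!}\operatorname{Alt}(\alpha\otimes\beta)$, where $\operatorname{Alt}(T)(x_1,\dots,x_m)=\frac1{m!}\sum_{\sigma\in S_m}\operatorname{sgn}(\sigma)T(x_{\sigma(1)},\dots,x_{\sigma(m)})$. The comass of an $m$-form $\alpha$ is $\|\alpha\|=\sup\{\alpha(\xi)\}$, the supremum over all simple $m$-vectors $\xi$ with Euclidean norm $|\xi|=1$. $|\cdot|$ is the Euclidean norm on forms for which wedge products of an orthonormal dual basis (increasing indices) are orthonormal; for a top form $c\,E_1\wedge\dots\wedge E_{2n}$ on $\mathbf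 R^{2n}$ it equals $|c|$. *)

theory Defs
  imports "HOL-Analysis.Analysis" "HOL-Combinatorics.Permutations"
begin

text \<open>
  A \<open>k\<close>-form on \<open>'a\<close> is a function of a sequence of vectors \<open>v 0, v 1, \<dots>\<close> that only looks at the
  first \<open>k\<close> of them. The last condition below makes equality of forms extensional equality.
\<close>

definition alternating_forms :: "nat \<Rightarrow> ((nat \<Rightarrow> 'a::real_vector) \<Rightarrow> real) set" where
  "alternating_forms k = {\<omega>.
     (\<forall>v. \<forall>i<k. linear (\<lambda>x. \<omega> (v(i := x)))) \<and>
     (\<forall>v. \<forall>i<k. \<forall>j<k. i \<noteq> j \<and> v i = v j \<longrightarrow> \<omega> v = 0) \<and>
     (\<forall>v w. (\<forall>i<k. v i = w i) \<longrightarrow> \<omega> v = \<omega> w)}"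

definition Alt :: "nat \<Rightarrow> ((nat \<Rightarrow> 'a) \<Rightarrow> real) \<Rightarrow> (nat \<Rightarrow> 'a) \<Rightarrow> real" where
  "Alt m T x = (1 / fact m) * (\<Sum>\<sigma> | \<sigma> permutes {..<m}. of_int (sign \<sigma>) * T (\<lambda>i. x (\<sigma> i)))"

definition tensor :: "nat \<Rightarrow> ((nat \<Rightarrow> 'a) \<Rightarrow> real) \<Rightarrow> ((nat \<Rightarrow> 'a) \<Rightarrow> real) \<Rightarrow> (nat \<Rightarrow> 'a) \<Rightarrow> real" where
  "tensor k S T x = S x * T (\<lambda>i. x (k + i))"

definition wedge ::
    "nat \<Rightarrow> nat \<Rightarrow> ((nat \<Rightarrow> 'a) \<Rightarrow> real) \<Rightarrow> ((nat \<Rightarrow> 'a) \<Rightarrow> real) \<Rightarrow> (nat \<Rightarrow> 'a) \<Rightarrow> real" where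
  "wedge k l \<alpha> \<beta> x = (fact (k + l) / (fact k * fact l)) * Alt (k + l) (tensor k \<alpha> \<beta>) x"

definition pullback :: "('b \<Rightarrow> 'a) \<Rightarrow> ((nat \<Rightarrow> 'a) \<Rightarrow> real) \<Rightarrow> (nat \<Rightarrow> 'b) \<Rightarrow> real" where
  "pullback f \<omega> v = \<omega> (\<lambda>i. f (v i))"

primrec wedge_covectors :: "(nat \<Rightarrow> 'a \<Rightarrow> real) \<Rightarrow> nat \<Rightarrow> (nat \<Rightarrow> 'a) \<Rightarrow> real" where
  "wedge_covectors \<phi> 0 = (\<lambda>v. 1)"
| "wedge_covectors \<phi> (Suc k) = wedge k 1 (wedge_covectors \<phi> k) (\<lambda>v. \<phi> k (v 0))"

text \<open>
  The type class provides the orthonormal set \<open>Basis\<close> without an order, so an enumeration is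
  fixed once and for all. The norms below do not depend on it: a different enumeration permutes
  the coordinates and changes some of their signs.
\<close>

definition basis_enum :: "nat \<Rightarrow> 'a::euclidean_space" where
  "basis_enum = (SOME e. bij_betw e {..<DIM('a)} Basis)"

text \<open>An increasing multi-index \<open>i\<^sub>1 < \<dots> < i\<^sub>k\<close> is represented by its set of entries.\<close>

definition multi_indices :: "nat \<Rightarrow> nat \<Rightarrow> nat set set" where
  "multi_indices N k = {I. I \<subseteq> {..<N} \<and> card I = k}"

definition basis_tuple :: "nat set \<Rightarrow> nat \<Rightarrow> 'a::euclidean_space" where
  "basis_tuple I r = basis_enum (sorted_list_of_set I ! r)"

definition dual_basis_form :: "nat set \<Rightarrow> (nat \<Rightarrow> 'a::euclidean_space) \<Rightarrow> real" where
  "dual_basis_form I = wedge_covectors (\<lambda>r x. basis_tuple I r \<bullet> x) (card I)"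

text \<open>
  The coefficient of a \<open>k\<close>-form \<open>\<omega>\<close> at \<open>dual_basis_form I\<close> is its value on the corresponding
  basis vectors.
\<close>

definition form_norm :: "nat \<Rightarrow> ((nat \<Rightarrow> 'a::euclidean_space) \<Rightarrow> real) \<Rightarrow> real" where
  "form_norm k \<omega> = sqrt (\<Sum>I\<in>multi_indices DIM('a) k. (\<omega> (basis_tuple I))\<^sup>2)"

text \<open>
  The space of \<open>m\<close>-vectors is identified with the dual of the space of alternating \<open>m\<close>-forms, so
  that the value \<open>\<alpha>(\<xi>)\<close> is \<open>\<xi> \<alpha>\<close> and \<open>v\<^sub>1 \<and> \<dots> \<and> v\<^sub>m\<close> is evaluation at \<open>(v\<^sub>1, \<dots>, v\<^sub>m)\<close>. The
  coordinates of \<open>\<xi>\<close> with respect to the wedge products of basis vectors are the values of \<open>\<xi>\<close> on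
  the forms \<open>dual_basis_form I\<close>.
\<close>

definition simple_mvectors :: "nat \<Rightarrow> (((nat \<Rightarrow> 'a::real_vector) \<Rightarrow> real) \<Rightarrow> real) set" where
  "simple_mvectors m = range (\<lambda>v. restrict (\<lambda>\<omega>. \<omega> v) (alternating_forms m))"

definition mvector_norm :: "nat \<Rightarrow> (((nat \<Rightarrow> 'a::euclidean_space) \<Rightarrow> real) \<Rightarrow> real) \<Rightarrow> real" where
  "mvector_norm m \<xi> = sqrt (\<Sum>I\<in>multi_indices DIM('a) m. (\<xi> (dual_basis_form I))\<^sup>2)"

definition comass :: "nat \<Rightarrow> ((nat \<Rightarrow> 'a::euclidean_space) \<Rightarrow> real) \<Rightarrow> real" where
  "comass m \<alpha> = Sup {\<xi> \<alpha> | \<xi>. \<xi> \<in> simple_mvectors m \<and> mvector_norm m \<xi> = 1}"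

end

theory Submission
  imports Defs
begin

text \<open>
  Evaluate \<open>\<alpha>\<^sub>1 \<and> \<alpha>\<^sub>2\<close> on the orthonormal diagonal vectors \<open>(e\<^sub>i, e\<^sub>i) / \<surd>2\<close>, where \<open>e\<^sub>i\<close> is an
  orthonormal basis: on the diagonal both copies restrict to \<open>\<alpha>\<close>, so the value is
  \<open>\<alpha>\<^sup>2(e\<^sub>1, \<dots>, e\<^sub>2\<^sub>n) / 2\<^sup>n\<close>, and replacing one \<open>e\<^sub>i\<close> by its negative adjusts the sign. That orthonormal
  vectors span a simple vector of norm one is Cauchy--Binet, obtained by expanding the form
  \<open>w \<mapsto> det (v\<^sub>i \<bullet> w\<^sub>j)\<close> in coordinates. The same expansion shows that the set whose supremum is the
  comass is bounded above; without this, \<open>Sup\<close> would be unspecified.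
\<close>

section \<open>Multilinear and alternating forms\<close>

text \<open>The alternation condition is dropped because \<open>tensor\<close> of two alternating
  forms is in general only multilinear, and this is what \<open>Alt\<close> is applied to.\<close>

definition multilinear_forms :: "nat \<Rightarrow> ((nat \<Rightarrow> 'a::real_vector) \<Rightarrow> real) set" where
  "multilinear_forms k = {\<omega>.
     (\<forall>v. \<forall>i<k. linear (\<lambda>x. \<omega> (v(i := x)))) \<and>
     (\<forall>v w. (\<forall>i<k. v i = w i) \<longrightarrow> \<omega> v = \<omega> w)}"

lemma multilinear_formsI:
  assumes "\<And>v i. i < k \<Longrightarrow> linear (\<lambda>x. \<omega> (v(i := x)))"
    and "\<And>v w. (\<And>i. i < k \<Longrightarrow> v i = w i) \<Longrightarrow> \<omega> v = \<omega> w"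
  shows "\<omega> \<in> multilinear_forms k"
  using assms unfolding multilinear_forms_def by blast

lemma multilinear_forms_linear:
  "\<omega> \<in> multilinear_forms k \<Longrightarrow> i < k \<Longrightarrow> linear (\<lambda>x. \<omega> (v(i := x)))"
  unfolding multilinear_forms_def by blast

lemma multilinear_forms_cong:
  "\<omega> \<in> multilinear_forms k \<Longrightarrow> (\<And>i. i < k \<Longrightarrow> v i = w i) \<Longrightarrow> \<omega> v = \<omega> w"
  unfolding multilinear_forms_def by blast

lemma alternating_forms_imp_multilinear:
  "\<omega> \<in> alternating_forms k \<Longrightarrow> \<omega> \<in> multilinear_forms k"
  unfolding multilinear_forms_def alternating_forms_def by blast

lemma alternating_forms_eq_0:
  "\<omega> \<in> alternating_forms k \<Longrightarrow> i < k \<Longrightarrow> j < k \<Longrightarrow> i \<noteq> j \<Longrightarrow> v i = v j \<Longrightarrow> \<omega> v = 0"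
  unfolding alternating_forms_def by blast

lemma alternating_formsI:
  assumes "\<omega> \<in> multilinear_forms k"
    and "\<And>v i j. i < k \<Longrightarrow> j < k \<Longrightarrow> i \<noteq> j \<Longrightarrow> v i = v j \<Longrightarrow> \<omega> v = 0"
  shows "\<omega> \<in> alternating_forms k"
  using assms unfolding multilinear_forms_def alternating_forms_def by blast

lemma alternating_forms_cmult:
  assumes "\<omega> \<in> alternating_forms k"
  shows "(\<lambda>v. c * \<omega> v) \<in> alternating_forms k"
proof (intro alternating_formsI multilinear_formsI)
  show "linear (\<lambda>x. c * \<omega> (v(i := x)))" if "i < k" for v i
    using linear_compose_scale_right
      [OF multilinear_forms_linear[OF alternating_forms_imp_multilinear[OF assms] that], of c]
    by simp
  show "c * \<omega> v = c * \<omega> w" if "\<And>i. i < k \<Longrightarrow> v i = w i" for v w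
    using multilinear_forms_cong[OF alternating_forms_imp_multilinear[OF assms] that] by simp
  show "c * \<omega> v = 0" if "i < k" "j < k" "i \<noteq> j" "v i = v j" for v i j
    using alternating_forms_eq_0[OF assms that] by simp
qed

section \<open>Antisymmetrization, products and pullbacks of forms\<close>

lemma permutes_lessThan_less: "\<sigma> permutes {..<m} \<Longrightarrow> \<sigma> i < m \<longleftrightarrow> i < m" for m :: nat
  using permutes_in_image[of \<sigma> "{..<m}" i] by simp

lemma permutes_lessThan_permutation: "\<sigma> permutes {..<m} \<Longrightarrow> permutation \<sigma>" for m :: nat
  using permutation_permutes by blast

text \<open>If two arguments agree, composing every permutation with their transposition changes
  each sign but no value of \<open>T\<close>, so the sum is its own negative.\<close>

lemma Alt_in_alternating_forms:
  assumes T: "T \<in> multilinear_forms m"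
  shows "Alt m T \<in> alternating_forms m"
proof (intro alternating_formsI multilinear_formsI)
  fix v :: "nat \<Rightarrow> 'a" and j assume j: "j < m"
  have "linear (\<lambda>x. of_int (sign \<sigma>) * T (\<lambda>i. (v(j := x)) (\<sigma> i)))"
    if \<sigma>: "\<sigma> permutes {..<m}" for \<sigma>
  proof -
    \<comment> \<open>Argument \<open>j\<close> is fed into slot \<open>inv \<sigma> j\<close> of
      \<open>T\<close>, so linearity of \<open>T\<close> is used in that slot.\<close>
    have "(\<lambda>i. (v(j := x)) (\<sigma> i)) = (\<lambda>i. v (\<sigma> i))(inv \<sigma> j := x)" for x
      by (rule ext) (simp add: eq_commute[of _ "inv \<sigma> j"] permutes_inv_eq[OF \<sigma>])
    moreover have "inv \<sigma> j < m"
      using j permutes_lessThan_less[OF permutes_inv[OF \<sigma>]] by simp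
    ultimately have "linear (\<lambda>x. T (\<lambda>i. (v(j := x)) (\<sigma> i)))"
      using multilinear_forms_linear[OF T] by simp
    from linear_compose_scale_right[OF this, of "of_int (sign \<sigma>)"] show ?thesis by simp
  qed
  then have "linear (\<lambda>x. \<Sum>\<sigma> | \<sigma> permutes {..<m}. of_int (sign \<sigma>) * T (\<lambda>i. (v(j := x)) (\<sigma> i)))"
    by (intro linear_compose_sum) auto
  from linear_compose_scale_right[OF this, of "1 / fact m"]
  show "linear (\<lambda>x. Alt m T (v(j := x)))" by (simp add: Alt_def)
next
  fix v w :: "nat \<Rightarrow> 'a" assume eq: "\<And>i. i < m \<Longrightarrow> v i = w i"
  show "Alt m T v = Alt m T w" unfolding Alt_def
    by (intro arg_cong2[where f = "(*)"] sum.cong refl multilinear_forms_cong[OF T])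
      (auto simp: eq permutes_lessThan_less)
next
  fix v :: "nat \<Rightarrow> 'a" and i j assume ij: "i < m" "j < m" "i \<noteq> j" "v i = v j"
  let ?t = "Transposition.transpose i j"
  let ?S = "\<Sum>\<sigma> | \<sigma> permutes {..<m}. of_int (sign \<sigma>) * T (\<lambda>r. v (\<sigma> r))"
  have t: "?t permutes {..<m}" using ij by (intro permutes_swap_id) auto
  have v: "v (?t r) = v r" for r using ij by (auto simp: Transposition.transpose_def)
  have "?S = (\<Sum>\<sigma> | \<sigma> permutes {..<m}. of_int (sign (?t \<circ> \<sigma>)) * T (\<lambda>r. v ((?t \<circ> \<sigma>) r)))"
    by (rule setum_permutations_compose_left[OF t])
  also have "\<dots> = (\<Sum>\<sigma> | \<sigma> permutes {..<m}. - (of_int (sign \<sigma>) * T (\<lambda>r. v (\<sigma> r))))"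
    by (intro sum.cong refl)
      (simp add: v sign_compose permutes_lessThan_permutation permutation_swap_id sign_swap_id ij)
  also have "\<dots> = - ?S" by (simp add: sum_negf)
  finally have "?S = 0" by simp
  then show "Alt m T v = 0" by (simp add: Alt_def)
qed

lemma tensor_in_multilinear_forms:
  assumes S: "S \<in> multilinear_forms k" and T: "T \<in> multilinear_forms l"
  shows "tensor k S T \<in> multilinear_forms (k + l)"
proof (intro multilinear_formsI)
  fix v :: "nat \<Rightarrow> 'a" and i assume i: "i < k + l"
  show "linear (\<lambda>x. tensor k S T (v(i := x)))"
  proof (cases "i < k")
    case True
    have "(\<lambda>r. (v(i := x)) (k + r)) = (\<lambda>r. v (k + r))" for x using True by auto
    with linear_compose_scale_right
      [OF multilinear_forms_linear[OF S True, of v], of "T (\<lambda>r. v (k + r))"]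
    show ?thesis by (simp add: tensor_def mult.commute)
  next
    case False
    \<comment> \<open>Past the first block, slot \<open>i\<close> of the product is slot
      \<open>i - k\<close> of \<open>T\<close>.\<close>
    have "(\<lambda>r. (v(i := x)) (k + r)) = (\<lambda>r. v (k + r))(i - k := x)" for x
      using False by (intro ext) auto
    moreover have "S (v(i := x)) = S v" for x
      by (rule multilinear_forms_cong[OF S]) (use False in auto)
    moreover have "i - k < l" using False i by simp
    note linear_compose_scale_right
      [OF multilinear_forms_linear[OF T this, of "\<lambda>r. v (k + r)"], of "S v"]
    ultimately show ?thesis by (simp add: tensor_def)
  qed
next
  fix v w :: "nat \<Rightarrow> 'a" assume "\<And>i. i < k + l \<Longrightarrow> v i = w i"
  then show "tensor k S T v = tensor k S T w" unfolding tensor_def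
    by (intro arg_cong2[where f = "(*)"] multilinear_forms_cong[OF S] multilinear_forms_cong[OF T])
      auto
qed

lemma wedge_in_alternating_forms:
  assumes "S \<in> multilinear_forms k" "T \<in> multilinear_forms l"
  shows "wedge k l S T \<in> alternating_forms (k + l)"
  unfolding wedge_def[abs_def]
  by (intro alternating_forms_cmult Alt_in_alternating_forms tensor_in_multilinear_forms assms)

lemma pullback_in_multilinear_forms:
  assumes f: "linear f" and \<omega>: "\<omega> \<in> multilinear_forms k"
  shows "pullback f \<omega> \<in> multilinear_forms k"
proof (intro multilinear_formsI)
  fix v :: "nat \<Rightarrow> 'a" and i assume i: "i < k"
  have "(\<lambda>r. f ((v(i := x)) r)) = (\<lambda>r. f (v r))(i := f x)" for x by auto
  with linear_compose[OF f multilinear_forms_linear[OF \<omega> i, of "\<lambda>r. f (v r)"]]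
  show "linear (\<lambda>x. pullback f \<omega> (v(i := x)))" by (simp add: pullback_def o_def)
qed (auto simp: pullback_def intro: multilinear_forms_cong[OF \<omega>])

section \<open>Permuting, scaling and expanding the arguments\<close>

text \<open>Polarization: as a function \<open>F\<close> of slots \<open>a\<close> and
  \<open>b\<close> the form is biadditive and zero on the diagonal. Expanding \<open>F\<close> at
  the sum \<open>v a + v b\<close> in both slots leaves only the two mixed terms, which must
  cancel.\<close>

lemma alternating_forms_transpose:
  assumes \<omega>: "\<omega> \<in> alternating_forms k" and ab: "a < k" "b < k" "a \<noteq> b"
  shows "\<omega> (\<lambda>i. v (Transposition.transpose a b i)) = - \<omega> v"
proof -
  note lin = multilinear_forms_linear[OF alternating_forms_imp_multilinear[OF \<omega>]]
  define F where "F x y = \<omega> (v(a := x, b := y))" for x y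
  have 0: "F x x = 0" for x
    unfolding F_def by (rule alternating_forms_eq_0[OF \<omega> ab]) auto
  have addr: "F x (y + z) = F x y + F x z" for x y z
    unfolding F_def using linear_add[OF lin[OF ab(2), of "v(a := x)"]] by simp
  have addl: "F (x + y) z = F x z + F y z" for x y z
    unfolding F_def using linear_add[OF lin[OF ab(1), of "v(b := z)"], of x y] ab
    by (simp add: fun_upd_twist)
  have "F (v b) (v a) + F (v a) (v b) = F (v a + v b) (v a + v b)"
    by (simp add: addr addl 0[of "v a"] 0[of "v b"])
  then have "F (v b) (v a) + F (v a) (v b) = 0" by (simp only: 0)
  moreover have "v(a := v b, b := v a) = (\<lambda>i. v (Transposition.transpose a b i))"
    by (auto simp: fun_eq_iff Transposition.transpose_def)
  ultimately show ?thesis by (simp add: F_def)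
qed

text \<open>Permutations are built up from transpositions, each of which contributes a factor
  \<open>-1\<close> to both sides.\<close>

lemma alternating_forms_permute:
  assumes \<omega>: "\<omega> \<in> alternating_forms k" and \<sigma>: "\<sigma> permutes {..<k}"
  shows "\<omega> (\<lambda>i. v (\<sigma> i)) = of_int (sign \<sigma>) * \<omega> v"
  using finite_lessThan[of k] \<sigma>
proof (induction rule: permutes_rev_induct)
  case (swap a b p)
  then show ?case
    using alternating_forms_transpose[OF \<omega>, of a b "\<lambda>i. v (p i)"]
    by (simp add: sign_compose[unfolded o_def] permutes_lessThan_permutation permutation_swap_id
        sign_swap_id)
qed (simp add: id_def)

lemma multilinear_forms_scale:
  assumes \<omega>: "\<omega> \<in> multilinear_forms k"
  shows "\<omega> (\<lambda>i. c i *\<^sub>R v i) = (\<Prod>i<k. c i) * \<omega> v"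
proof -
  \<comment> \<open>The scalars are pulled out one slot at a time: only the first \<open>m\<close>
    arguments are scaled.\<close>
  have "\<omega> (\<lambda>i. if i < m then c i *\<^sub>R v i else v i) = (\<Prod>i<m. c i) * \<omega> v" if "m \<le> k" for m
    using that
  proof (induction m)
    case (Suc m)
    let ?w = "\<lambda>i. if i < m then c i *\<^sub>R v i else v i"
    have "(\<lambda>i. if i < Suc m then c i *\<^sub>R v i else v i) = ?w(m := c m *\<^sub>R v m)" by auto
    then have "\<omega> (\<lambda>i. if i < Suc m then c i *\<^sub>R v i else v i) = c m * \<omega> (?w(m := v m))"
      using linear_scale[OF multilinear_forms_linear[OF \<omega>, of m ?w]] Suc.prems by simp
    also have "?w(m := v m) = ?w" by auto
    finally show ?case using Suc by simp
  qed simp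
  from this[of k] have "\<omega> (\<lambda>i. if i < k then c i *\<^sub>R v i else v i) = (\<Prod>i<k. c i) * \<omega> v" by simp
  moreover have "\<omega> (\<lambda>i. if i < k then c i *\<^sub>R v i else v i) = \<omega> (\<lambda>i. c i *\<^sub>R v i)"
    by (rule multilinear_forms_cong[OF \<omega>]) simp
  ultimately show ?thesis by simp
qed

text \<open>The slots are expanded one after another, by induction on the number \<open>m\<close> of
  slots already treated; the others still hold \<open>v\<close>. The extensional function space
  \<open>PiE\<close> contains each choice of indices exactly once.\<close>

lemma multilinear_forms_expand:
  assumes \<omega>: "\<omega> \<in> multilinear_forms k" and "finite J"
    and v: "\<And>i. i < k \<Longrightarrow> v i = (\<Sum>j\<in>J. c i j *\<^sub>R e j)"
  shows "\<omega> v = (\<Sum>f\<in>{..<k} \<rightarrow>\<^sub>E J. (\<Prod>i<k. c i (f i)) * \<omega> (\<lambda>i. e (f i)))"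
proof -
  have "\<omega> v = (\<Sum>f\<in>{..<m} \<rightarrow>\<^sub>E J. (\<Prod>i<m. c i (f i)) * \<omega> (\<lambda>i. if i < m then e (f i) else v i))"
    if "m \<le> k" for m
    using that
  proof (induction m)
    case (Suc m)
    let ?w = "\<lambda>f i. if i < m then e (f i) else v i"
    have step: "\<omega> (?w f) = (\<Sum>j\<in>J. c m j * \<omega> ((?w f)(m := e j)))" for f
    proof -
      \<comment> \<open>Slot \<open>m\<close> of \<open>?w f\<close> still holds \<open>v m\<close>,
        which is the given linear combination.\<close>
      have "?w f = (?w f)(m := \<Sum>j\<in>J. c m j *\<^sub>R e j)" using v[of m] Suc.prems by auto
      then have "\<omega> (?w f) = \<omega> ((?w f)(m := \<Sum>j\<in>J. c m j *\<^sub>R e j))" by (rule arg_cong)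
      also have "\<dots> = (\<Sum>j\<in>J. \<omega> ((?w f)(m := c m j *\<^sub>R e j)))"
        using linear_sum[OF multilinear_forms_linear[OF \<omega>, of m "?w f"],
          of "\<lambda>j. c m j *\<^sub>R e j" J] Suc.prems by simp
      also have "\<dots> = (\<Sum>j\<in>J. c m j * \<omega> ((?w f)(m := e j)))"
        using linear_scale[OF multilinear_forms_linear[OF \<omega>, of m "?w f"]] Suc.prems
        by (intro sum.cong) auto
      finally show ?thesis .
    qed
    let ?g = "\<lambda>f. (\<Prod>i<Suc m. c i (f i)) * \<omega> (\<lambda>i. if i < Suc m then e (f i) else v i)"
    have ext: "?g (f(m := j)) = (\<Prod>i<m. c i (f i)) * (c m j * \<omega> ((?w f)(m := e j)))" for f j
    proof -
      have "(\<lambda>i. if i < Suc m then e ((f(m := j)) i) else v i) = (?w f)(m := e j)" by auto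
      then show ?thesis by simp
    qed
    \<comment> \<open>An index function on \<open>Suc m\<close> slots is an index function on
      \<open>m\<close> slots together with its value \<open>j\<close> at \<open>m\<close>.\<close>
    have "(\<Sum>f\<in>{..<Suc m} \<rightarrow>\<^sub>E J. ?g f) = (\<Sum>f\<in>insert m {..<m} \<rightarrow>\<^sub>E J. ?g f)"
      by (simp add: lessThan_Suc)
    also have "\<dots> = (\<Sum>(j, f)\<in>J \<times> ({..<m} \<rightarrow>\<^sub>E J). ?g (f(m := j)))"
      unfolding PiE_insert_eq
      by (subst sum.reindex[OF inj_combinator]) (auto simp: case_prod_unfold o_def)
    also have "\<dots> = (\<Sum>f\<in>{..<m} \<rightarrow>\<^sub>E J. \<Sum>j\<in>J. ?g (f(m := j)))"
      by (subst sum.swap) (rule sum.cartesian_product[symmetric])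
    also have "\<dots> = (\<Sum>f\<in>{..<m} \<rightarrow>\<^sub>E J. (\<Prod>i<m. c i (f i)) * \<omega> (?w f))"
      by (simp only: ext step sum_distrib_left)
    also have "\<dots> = \<omega> v" using Suc by simp
    finally show ?case ..
  qed simp
  from this[of k] have "\<omega> v =
      (\<Sum>f\<in>{..<k} \<rightarrow>\<^sub>E J. (\<Prod>i<k. c i (f i)) * \<omega> (\<lambda>i. if i < k then e (f i) else v i))" by simp
  also have "\<dots> = (\<Sum>f\<in>{..<k} \<rightarrow>\<^sub>E J. (\<Prod>i<k. c i (f i)) * \<omega> (\<lambda>i. e (f i)))"
  proof (intro sum.cong refl)
    fix f
    have "\<omega> (\<lambda>i. if i < k then e (f i) else v i) = \<omega> (\<lambda>i. e (f i))"
      by (rule multilinear_forms_cong[OF \<omega>]) simp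
    then show "(\<Prod>i<k. c i (f i)) * \<omega> (\<lambda>i. if i < k then e (f i) else v i)
        = (\<Prod>i<k. c i (f i)) * \<omega> (\<lambda>i. e (f i))" by simp
  qed
  finally show ?thesis .
qed

section \<open>Wedge products of covectors\<close>

text \<open>This is the Leibniz formula for the determinant of the matrix with entries
  \<open>\<phi> i (v j)\<close>. The induction step gives a double sum over permutations of
  \<open>Suc k\<close> and of \<open>k\<close> elements; the latter are absorbed into the former,
  and the resulting factor \<open>fact k\<close> cancels the normalization of
  \<open>wedge\<close>.\<close>

lemma wedge_covectors_eq:
  "wedge_covectors \<phi> k v =
     (\<Sum>\<sigma> | \<sigma> permutes {..<k}. of_int (sign \<sigma>) * (\<Prod>i<k. \<phi> i (v (\<sigma> i))))"
proof (induction k arbitrary: v)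
  case (Suc k)
  let ?G = "\<lambda>\<rho>. of_int (sign \<rho>) * (\<Prod>i<Suc k. \<phi> i (v (\<rho> i)))"
  let ?P = "\<lambda>k. {\<sigma>. \<sigma> permutes {..<k::nat}}"
  have "wedge_covectors \<phi> (Suc k) v
      = (1 / fact k) * (\<Sum>\<sigma>\<in>?P (Suc k). of_int (sign \<sigma>) *
          ((\<Sum>\<tau>\<in>?P k. of_int (sign \<tau>) * (\<Prod>i<k. \<phi> i (v (\<sigma> (\<tau> i))))) * \<phi> k (v (\<sigma> k))))"
    by (simp add: wedge_def Alt_def tensor_def Suc.IH field_simps del: fact_Suc)
  also have "(\<Sum>\<sigma>\<in>?P (Suc k). of_int (sign \<sigma>) *
          ((\<Sum>\<tau>\<in>?P k. of_int (sign \<tau>) * (\<Prod>i<k. \<phi> i (v (\<sigma> (\<tau> i))))) * \<phi> k (v (\<sigma> k))))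
      = (\<Sum>\<sigma>\<in>?P (Suc k). \<Sum>\<tau>\<in>?P k. ?G (\<sigma> \<circ> \<tau>))"
  proof (intro sum.cong refl)
    fix \<sigma> assume "\<sigma> \<in> ?P (Suc k)"
    then have "of_int (sign \<sigma>) * (of_int (sign \<tau>) * (\<Prod>i<k. \<phi> i (v (\<sigma> (\<tau> i)))) * \<phi> k (v (\<sigma> k)))
        = ?G (\<sigma> \<circ> \<tau>)" if "\<tau> permutes {..<k}" for \<tau>
      \<comment> \<open>Since \<open>\<tau>\<close> fixes \<open>k\<close>, the separate last factor
        is the factor with index \<open>k\<close> of the product for
        \<open>\<sigma> \<circ> \<tau>\<close>.\<close>
      using that permutes_not_in[OF that, of k]
      by (simp add: sign_compose permutes_lessThan_permutation)
    then show "of_int (sign \<sigma>) *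
        ((\<Sum>\<tau>\<in>?P k. of_int (sign \<tau>) * (\<Prod>i<k. \<phi> i (v (\<sigma> (\<tau> i))))) * \<phi> k (v (\<sigma> k)))
      = (\<Sum>\<tau>\<in>?P k. ?G (\<sigma> \<circ> \<tau>))"
      unfolding sum_distrib_left sum_distrib_right by (intro sum.cong refl) blast
  qed
  also have "\<dots> = (\<Sum>\<tau>\<in>?P k. \<Sum>\<sigma>\<in>?P (Suc k). ?G (\<sigma> \<circ> \<tau>))" by (rule sum.swap)
  \<comment> \<open>Right translation by \<open>\<tau>\<close> permutes the index set of the inner
    sum, which therefore does not depend on \<open>\<tau>\<close>.\<close>
  also have "\<dots> = (\<Sum>\<tau>\<in>?P k. \<Sum>\<sigma>\<in>?P (Suc k). ?G \<sigma>)"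
    by (intro sum.cong refl sum_permutations_compose_right[symmetric])
      (auto intro: permutes_subset)
  also have "\<dots> = fact k * (\<Sum>\<sigma>\<in>?P (Suc k). ?G \<sigma>)"
    by (simp add: card_permutations)
  finally show ?case by simp
qed simp

lemma wedge_covectors_in_alternating_forms:
  assumes "\<And>i. i < k \<Longrightarrow> linear (\<phi> i)"
  shows "wedge_covectors \<phi> k \<in> alternating_forms k"
  using assms
proof (induction k)
  case 0
  show ?case by (auto simp: alternating_forms_def)
next
  case (Suc k)
  have "(\<lambda>v. \<phi> k (v 0)) \<in> multilinear_forms 1"
    using Suc.prems by (auto intro!: multilinear_formsI)
  moreover have "wedge_covectors \<phi> k \<in> multilinear_forms k"
    using Suc by (intro alternating_forms_imp_multilinear) auto
  ultimately show ?case using wedge_in_alternating_forms[of _ k _ 1] by simp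
qed

text \<open>A matrix and its transpose have the same determinant; the matrix here has entries
  \<open>a i \<bullet> b j\<close>. Inverting the summation permutation and reindexing the product
  exchanges rows and columns.\<close>

lemma wedge_covectors_inner_commute:
  "wedge_covectors (\<lambda>i x. a i \<bullet> x) k b = wedge_covectors (\<lambda>i x. b i \<bullet> x) k a"
proof -
  have "wedge_covectors (\<lambda>i x. a i \<bullet> x) k b
      = (\<Sum>\<sigma> | \<sigma> permutes {..<k}. of_int (sign (inv \<sigma>)) * (\<Prod>i<k. a i \<bullet> b (inv \<sigma> i)))"
    unfolding wedge_covectors_eq by (rule sum_permutations_inverse)
  also have "\<dots> = (\<Sum>\<sigma> | \<sigma> permutes {..<k}. of_int (sign \<sigma>) * (\<Prod>i<k. b i \<bullet> a (\<sigma> i)))"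
  proof (intro sum.cong refl, clarify)
    fix \<sigma> assume \<sigma>: "\<sigma> permutes {..<k}"
    have "(\<Prod>i<k. a i \<bullet> b (inv \<sigma> i)) = (\<Prod>i<k. a (\<sigma> i) \<bullet> b (inv \<sigma> (\<sigma> i)))"
      using prod.permute[OF \<sigma>, of "\<lambda>i. a i \<bullet> b (inv \<sigma> i)"] by (simp add: o_def)
    then show "of_int (sign (inv \<sigma>)) * (\<Prod>i<k. a i \<bullet> b (inv \<sigma> i))
        = of_int (sign \<sigma>) * (\<Prod>i<k. b i \<bullet> a (\<sigma> i))"
      using \<sigma> by (simp add: permutes_inverses sign_inverse permutes_lessThan_permutation inner_commute)
  qed
  finally show ?thesis unfolding wedge_covectors_eq .
qed

text \<open>The Gram matrix is the identity: a permutation that moves some \<open>i\<close> has the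
  factor \<open>a i \<bullet> a (\<sigma> i) = 0\<close>.\<close>

lemma wedge_covectors_orthonormal:
  assumes "\<And>i j. i < k \<Longrightarrow> j < k \<Longrightarrow> a i \<bullet> a j = (if i = j then 1 else 0)"
  shows "wedge_covectors (\<lambda>i x. a i \<bullet> x) k a = 1"
proof -
  have "(\<Prod>i<k. a i \<bullet> a (\<sigma> i)) = 0" if \<sigma>: "\<sigma> permutes {..<k}" "\<sigma> \<noteq> id" for \<sigma>
  proof -
    obtain i where "\<sigma> i \<noteq> i" using \<sigma> by (auto simp: fun_eq_iff)
    moreover have "i < k" using \<sigma> \<open>\<sigma> i \<noteq> i\<close> by (metis lessThan_iff permutes_not_in)
    ultimately show ?thesis using assms permutes_lessThan_less[OF \<sigma>(1)]
      by (intro prod_zero) (auto intro!: bexI[of _ i])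
  qed
  then have "wedge_covectors (\<lambda>i x. a i \<bullet> x) k a
      = (\<Sum>\<sigma>\<in>{id}. of_int (sign \<sigma>) * (\<Prod>i<k. a i \<bullet> a (\<sigma> i)))"
    unfolding wedge_covectors_eq
    by (intro sum.mono_neutral_right) (auto simp: finite_permutations permutes_id)
  then show ?thesis using assms by simp
qed

section \<open>Coordinates of alternating forms\<close>

lemma bij_betw_basis_enum: "bij_betw basis_enum {..<DIM('a)} (Basis :: 'a::euclidean_space set)"
proof -
  have "\<exists>e. bij_betw e {..<DIM('a)} (Basis :: 'a set)"
    using ex_bij_betw_nat_finite[of "Basis :: 'a set"] by (simp add: atLeast0LessThan)
  then show ?thesis unfolding basis_enum_def by (rule someI_ex)
qed

lemma basis_enum_inner:
  assumes "i < DIM('a)" "j < DIM('a)"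
  shows "basis_enum i \<bullet> (basis_enum j :: 'a::euclidean_space) = (if i = j then 1 else 0)"
proof -
  have "basis_enum i \<in> (Basis :: 'a set)" "basis_enum j \<in> (Basis :: 'a set)"
    using bij_betw_apply[OF bij_betw_basis_enum] assms by auto
  moreover have "basis_enum i = (basis_enum j :: 'a) \<longleftrightarrow> i = j"
    using bij_betw_imp_inj_on[OF bij_betw_basis_enum[where 'a = 'a]] assms
    by (auto simp: inj_on_eq_iff)
  ultimately show ?thesis by (simp add: inner_Basis)
qed

lemma basis_enum_expand:
  "v = (\<Sum>j<DIM('a). (basis_enum j \<bullet> v) *\<^sub>R (basis_enum j :: 'a::euclidean_space))"
proof -
  have "v = (\<Sum>b\<in>Basis. (b \<bullet> v) *\<^sub>R b)"
    by (simp add: inner_commute[of _ v] euclidean_representation)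
  also have "\<dots> = (\<Sum>j<DIM('a). (basis_enum j \<bullet> v) *\<^sub>R basis_enum j)"
    using sum.reindex_bij_betw[OF bij_betw_basis_enum, of "\<lambda>b. (b \<bullet> v) *\<^sub>R b"] by simp
  finally show ?thesis .
qed

lemma finite_multi_indices: "finite (multi_indices N k)"
  unfolding multi_indices_def by simp

lemma dual_basis_form_in_alternating_forms:
  "I \<in> multi_indices N k \<Longrightarrow> dual_basis_form I \<in> alternating_forms k"
  unfolding dual_basis_form_def multi_indices_def
  using wedge_covectors_in_alternating_forms[of "card I" "\<lambda>r x. basis_tuple I r \<bullet> x"]
  by (auto simp: bounded_linear.linear bounded_linear_inner_right)

text \<open>Once a bijection \<open>s\<close> onto \<open>I\<close> is fixed, the injections with
  image \<open>I\<close> are exactly the maps \<open>s \<circ> \<sigma>\<close>, with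
  \<open>\<sigma>\<close> recovered by applying the inverse of \<open>s\<close>. If \<open>I\<close>
  is not contained in \<open>J\<close>, both sums are empty.\<close>

lemma sum_injections_onto:
  assumes s: "bij_betw s {..<k::nat} I"
  shows "(\<Sum>f | f \<in> {..<k} \<rightarrow>\<^sub>E J \<and> inj_on f {..<k} \<and> f ` {..<k} = I. g f)
       = (\<Sum>\<sigma> | \<sigma> permutes {..<k} \<and> I \<subseteq> J. g (restrict (s \<circ> \<sigma>) {..<k}))"
proof (rule sum.reindex_bij_witness[where i = "\<lambda>\<sigma>. restrict (s \<circ> \<sigma>) {..<k}"
      and j = "\<lambda>f i. if i < k then inv_into {..<k} s (f i) else i"], goal_cases)
  case (1 f)
  then show ?case using bij_betw_inv_into_right[OF s]
    by (auto simp: fun_eq_iff PiE_def extensional_def restrict_def)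
next
  case (2 f)
  have f: "bij_betw f {..<k} I" using 2 by (simp add: bij_betw_def)
  have "bij_betw (inv_into {..<k} s \<circ> f) {..<k} {..<k}"
    using bij_betw_trans[OF f bij_betw_inv_into[OF s]] .
  then have "bij_betw (\<lambda>i. if i < k then inv_into {..<k} s (f i) else i) {..<k} {..<k}"
    by (rule bij_betw_cong[THEN iffD1, rotated]) simp
  then have "(\<lambda>i. if i < k then inv_into {..<k} s (f i) else i) permutes {..<k}"
    by (rule bij_imp_permutes) simp
  moreover have "I \<subseteq> J" using 2 by (auto simp: PiE_iff)
  ultimately show ?case by blast
next
  case (3 \<sigma>)
  then show ?case using bij_betw_inv_into_left[OF s] permutes_lessThan_less[of \<sigma> k]
    by (auto simp: fun_eq_iff permutes_not_in)
next
  case (4 \<sigma>)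
  have b: "bij_betw (restrict (s \<circ> \<sigma>) {..<k}) {..<k} I"
    using bij_betw_trans[OF permutes_imp_bij s] 4 by simp
  then show ?case using 4 by (auto simp: bij_betw_def)
next
  case (5 f)
  then have "restrict (s \<circ> (\<lambda>i. if i < k then inv_into {..<k} s (f i) else i)) {..<k} = f"
    using bij_betw_inv_into_right[OF s]
    by (auto simp: fun_eq_iff PiE_def extensional_def restrict_def)
  then show ?case by simp
qed

text \<open>After full multilinear expansion only injective index functions survive. Those with
  image \<open>I\<close> differ from the increasing one by a permutation, and their signed
  coefficients add up to a determinant.\<close>

lemma alternating_forms_expand:
  fixes \<omega> :: "(nat \<Rightarrow> 'a::euclidean_space) \<Rightarrow> real"
  assumes \<omega>: "\<omega> \<in> alternating_forms k"
  shows "\<omega> v = (\<Sum>I\<in>multi_indices DIM('a) k. \<omega> (basis_tuple I) * dual_basis_form I v)"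
proof -
  note ml = alternating_forms_imp_multilinear[OF \<omega>]
  let ?b = "basis_enum :: nat \<Rightarrow> 'a"
  let ?M = "multi_indices DIM('a) k"
  let ?F = "{..<k} \<rightarrow>\<^sub>E {..<DIM('a)}"
  let ?S = "{f \<in> ?F. inj_on f {..<k}}"
  define g where "g f = (\<Prod>i<k. ?b (f i) \<bullet> v i) * \<omega> (\<lambda>i. ?b (f i))" for f
  have fin: "finite ?F" by (intro finite_PiE) auto
  have "\<omega> v = (\<Sum>f\<in>?F. g f)" unfolding g_def
    by (rule multilinear_forms_expand[OF ml]) (auto intro: basis_enum_expand)
  also have "\<dots> = (\<Sum>f\<in>?S. g f)"
  proof (intro sum.mono_neutral_right ballI)
    fix f assume "f \<in> ?F - ?S"
    then obtain i j where "i < k" "j < k" "i \<noteq> j" "f i = f j" by (auto simp: inj_on_def)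
    then have "\<omega> (\<lambda>i. ?b (f i)) = 0" by (intro alternating_forms_eq_0[OF \<omega>, of i j]) auto
    then show "g f = 0" by (simp add: g_def)
  qed (use fin in auto)
  also have "\<dots> = (\<Sum>I\<in>?M. \<Sum>f | f \<in> ?S \<and> f ` {..<k} = I. g f)"
  proof (rule sum.group[symmetric])
    show "(\<lambda>f. f ` {..<k}) ` ?S \<subseteq> ?M"
      by (auto simp: multi_indices_def card_image PiE_iff)
  qed (use fin finite_multi_indices in auto)
  also have "\<dots> = (\<Sum>I\<in>?M. \<omega> (basis_tuple I) * dual_basis_form I v)"
  proof (intro sum.cong refl)
    fix I assume I: "I \<in> ?M"
    then have finI: "finite I" and IN: "I \<subseteq> {..<DIM('a)}" and k: "k = card I"
      by (auto simp: multi_indices_def intro: finite_subset)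
    let ?s = "\<lambda>r. sorted_list_of_set I ! r"
    have s: "bij_betw ?s {..<k} I"
      using finI by (intro bij_betw_nth) (auto simp: k)
    have "(\<Sum>f | f \<in> ?S \<and> f ` {..<k} = I. g f)
        = (\<Sum>\<sigma> | \<sigma> permutes {..<k}. g (restrict (?s \<circ> \<sigma>) {..<k}))"
      using sum_injections_onto[OF s, where J = "{..<DIM('a)}" and g = g] IN by (simp add: conj_ac)
    also have "\<dots> = (\<Sum>\<sigma> | \<sigma> permutes {..<k}. \<omega> (basis_tuple I) *
        (of_int (sign \<sigma>) * (\<Prod>i<k. v i \<bullet> basis_tuple I (\<sigma> i))))"
    proof (intro sum.cong refl, clarify)
      fix \<sigma> assume \<sigma>: "\<sigma> permutes {..<k}"
      have "\<omega> (\<lambda>i. ?b (restrict (?s \<circ> \<sigma>) {..<k} i)) = \<omega> (\<lambda>i. basis_tuple I (\<sigma> i))"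
        by (rule multilinear_forms_cong[OF ml]) (simp add: basis_tuple_def)
      also have "\<dots> = of_int (sign \<sigma>) * \<omega> (basis_tuple I)"
        by (rule alternating_forms_permute[OF \<omega> \<sigma>])
      finally show "g (restrict (?s \<circ> \<sigma>) {..<k}) = \<omega> (basis_tuple I) *
          (of_int (sign \<sigma>) * (\<Prod>i<k. v i \<bullet> basis_tuple I (\<sigma> i)))"
        by (simp add: g_def basis_tuple_def inner_commute[of "v _"])
    qed
    \<comment> \<open>The sum is the Leibniz formula with the vectors \<open>v i\<close> as
      covectors; transposition then turns it into the dual basis form evaluated at
      \<open>v\<close>.\<close>
    also have "\<dots> = \<omega> (basis_tuple I) * wedge_covectors (\<lambda>i x. v i \<bullet> x) k (basis_tuple I)"
      by (simp only: wedge_covectors_eq sum_distrib_left)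
    also have "\<dots> = \<omega> (basis_tuple I) * dual_basis_form I v"
      by (simp add: wedge_covectors_inner_commute[of v] dual_basis_form_def k)
    finally show "(\<Sum>f | f \<in> ?S \<and> f ` {..<k} = I. g f) = \<omega> (basis_tuple I) * dual_basis_form I v" .
  qed
  finally show ?thesis .
qed

text \<open>Cauchy--Binet: the right-hand side is the Gram determinant of \<open>v\<close>.\<close>

lemma sum_dual_basis_form_squared:
  fixes v :: "nat \<Rightarrow> 'a::euclidean_space"
  shows "(\<Sum>I\<in>multi_indices DIM('a) k. (dual_basis_form I v)\<^sup>2)
       = wedge_covectors (\<lambda>i x. v i \<bullet> x) k v"
proof -
  have "wedge_covectors (\<lambda>i x. v i \<bullet> x) k \<in> alternating_forms k"
    by (intro wedge_covectors_in_alternating_forms bounded_linear.linear bounded_linear_inner_right)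
  from alternating_forms_expand[OF this, of v]
  have "wedge_covectors (\<lambda>i x. v i \<bullet> x) k v = (\<Sum>I\<in>multi_indices DIM('a) k.
      wedge_covectors (\<lambda>i x. v i \<bullet> x) k (basis_tuple I) * dual_basis_form I v)" .
  also have "\<dots> = (\<Sum>I\<in>multi_indices DIM('a) k. (dual_basis_form I v)\<^sup>2)"
    \<comment> \<open>By transposition the coefficient at \<open>I\<close> is itself
      \<open>dual_basis_form I v\<close>, so every term is a square.\<close>
    by (intro sum.cong refl)
      (auto simp: wedge_covectors_inner_commute[of v] dual_basis_form_def multi_indices_def
        power2_eq_square)
  finally show ?thesis ..
qed

text \<open>In top degree there is a single multi-index, and its increasing tuple is
  \<open>basis_enum\<close> itself.\<close>

lemma form_norm_top:
  fixes \<omega> :: "(nat \<Rightarrow> 'a::euclidean_space) \<Rightarrow> real"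
  assumes \<omega>: "\<omega> \<in> multilinear_forms DIM('a)"
  shows "form_norm DIM('a) \<omega> = \<bar>\<omega> basis_enum\<bar>"
proof -
  have "multi_indices DIM('a) DIM('a) = {{..<DIM('a)}}"
    unfolding multi_indices_def using card_subset_eq[of "{..<DIM('a)}"] by auto
  moreover have "\<omega> (basis_tuple {..<DIM('a)}) = \<omega> basis_enum"
    by (rule multilinear_forms_cong[OF \<omega>]) (simp add: basis_tuple_def lessThan_atLeast0)
  ultimately show ?thesis by (simp add: form_norm_def)
qed

section \<open>The comass\<close>

lemma mvector_norm_simple:
  fixes v :: "nat \<Rightarrow> 'a::euclidean_space"
  shows "mvector_norm m (restrict (\<lambda>\<omega>. \<omega> v) (alternating_forms m))
       = sqrt (\<Sum>I\<in>multi_indices DIM('a) m. (dual_basis_form I v)\<^sup>2)"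
  unfolding mvector_norm_def
  by (intro arg_cong[where f = sqrt] sum.cong refl)
    (simp add: dual_basis_form_in_alternating_forms)

text \<open>Evaluation at \<open>v\<close> is a competitor in the supremum, because its squared norm
  is the Gram determinant of \<open>v\<close>, which is 1.\<close>

lemma comass_ge_orthonormal:
  fixes v :: "nat \<Rightarrow> 'a::euclidean_space"
  assumes \<omega>: "\<omega> \<in> alternating_forms m"
    and v: "\<And>i j. i < m \<Longrightarrow> j < m \<Longrightarrow> v i \<bullet> v j = (if i = j then 1 else 0)"
  shows "\<omega> v \<le> comass m \<omega>"
  unfolding comass_def
proof (rule cSup_upper)
  let ?\<xi> = "\<lambda>v :: nat \<Rightarrow> 'a. restrict (\<lambda>\<omega>. \<omega> v) (alternating_forms m)"
  let ?M = "multi_indices DIM('a) m"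
  have "mvector_norm m (?\<xi> v) = 1"
    using wedge_covectors_orthonormal[of m v] v
    by (simp add: mvector_norm_simple sum_dual_basis_form_squared)
  then show "\<omega> v \<in> {\<xi> \<omega> | \<xi>. \<xi> \<in> simple_mvectors m \<and> mvector_norm m \<xi> = 1}"
    using \<omega> by (auto simp: simple_mvectors_def intro!: exI[of _ "?\<xi> v"])
  show "bdd_above {\<xi> \<omega> | \<xi>. \<xi> \<in> simple_mvectors m \<and> mvector_norm m \<xi> = 1}"
  proof (rule bdd_aboveI)
    fix y assume "y \<in> {\<xi> \<omega> | \<xi>. \<xi> \<in> simple_mvectors m \<and> mvector_norm m \<xi> = 1}"
    then obtain u where y: "y = \<omega> u" and "mvector_norm m (?\<xi> u) = 1"
      using \<omega> by (auto simp: simple_mvectors_def)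
    then have 1: "(\<Sum>I\<in>?M. (dual_basis_form I u)\<^sup>2) = 1"
      by (simp add: mvector_norm_simple)
    \<comment> \<open>A unit simple vector has all coordinates in the interval from -1 to 1, so the
      sum of the absolute coefficients of \<open>\<omega>\<close> is a bound independent of
      \<open>u\<close>.\<close>
    have "y \<le> (\<Sum>I\<in>?M. \<bar>\<omega> (basis_tuple I)\<bar>)"
      unfolding y alternating_forms_expand[OF \<omega>, of u]
    proof (rule sum_mono)
      fix I assume "I \<in> ?M"
      then have "(dual_basis_form I u)\<^sup>2 \<le> 1"
        unfolding 1[symmetric] using finite_multi_indices by (intro member_le_sum) auto
      then have "\<bar>\<omega> (basis_tuple I)\<bar> * \<bar>dual_basis_form I u\<bar> \<le> \<bar>\<omega> (basis_tuple I)\<bar>"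
        by (simp add: abs_square_le_1 mult_left_le)
      then show "\<omega> (basis_tuple I) * dual_basis_form I u \<le> \<bar>\<omega> (basis_tuple I)\<bar>"
        by (simp flip: abs_mult)
    qed
    then show "y \<le> (\<Sum>I\<in>?M. \<bar>\<omega> (basis_tuple I)\<bar>)" .
  qed
qed

section \<open>Evaluation on the diagonal\<close>

theorem proposition1p3:
  fixes \<alpha> :: "(nat \<Rightarrow> real ^ 'm) \<Rightarrow> real" and n :: nat
  assumes "CARD('m) = 2 * n"
    and "\<alpha> \<in> alternating_forms n"
  shows "comass (2 * n) (wedge n n (pullback fst \<alpha>) (pullback snd \<alpha>)
           :: (nat \<Rightarrow> (real ^ 'm) \<times> (real ^ 'm)) \<Rightarrow> real)
         \<ge> form_norm (2 * n) (wedge n n \<alpha> \<alpha>) / 2 ^ n"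
proof -
  let ?e = "basis_enum :: nat \<Rightarrow> real ^ 'm"
  let ?\<Omega> = "wedge n n (pullback fst \<alpha>) (pullback snd \<alpha>)
    :: (nat \<Rightarrow> (real ^ 'm) \<times> (real ^ 'm)) \<Rightarrow> real"
  have dim: "DIM(real ^ 'm) = 2 * n" using assms(1) by simp
  \<comment> \<open>Positivity ensures that slot 0, which is to carry the sign, exists.\<close>
  have "0 < CARD('m)" by simp
  then have n: "0 < 2 * n" using assms(1) by simp
  note \<alpha> = alternating_forms_imp_multilinear[OF assms(2)]
  have "wedge n n \<alpha> \<alpha> \<in> alternating_forms (n + n)"
    by (intro wedge_in_alternating_forms \<alpha>)
  then have top: "wedge n n \<alpha> \<alpha> \<in> multilinear_forms (2 * n)"
    by (simp add: alternating_forms_imp_multilinear mult_2)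
  have "?\<Omega> \<in> alternating_forms (n + n)"
    by (intro wedge_in_alternating_forms pullback_in_multilinear_forms \<alpha> linear_fst linear_snd)
  then have \<Omega>: "?\<Omega> \<in> alternating_forms (2 * n)" by (simp add: mult_2)
  \<comment> \<open>Multiplying by \<open>s\<close> turns the value on the basis into its absolute
    value; the choice 1 at value zero keeps \<open>s * s = 1\<close>.\<close>
  define s :: real where "s = (if wedge n n \<alpha> \<alpha> ?e < 0 then - 1 else 1)"
  define c where "c i = (if i = 0 then s else 1) / sqrt 2" for i :: nat
  define x where "x i = c i *\<^sub>R ?e i" for i
  have c2: "c i * c i = 1 / 2" for i by (simp add: c_def s_def)
  have "(\<Prod>i<2 * n. c i) = (\<Prod>i<2 * n. if i = 0 then s else 1) / sqrt 2 ^ (2 * n)"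
    by (simp add: c_def prod_dividef)
  also have "(\<Prod>i<2 * n. if i = 0 then s else 1) = s"
    using n by (simp add: prod.delta)
  also have "sqrt 2 ^ (2 * n) = 2 ^ n" by (simp add: power_mult)
  finally have prod_c: "(\<Prod>i<2 * n. c i) = s / 2 ^ n" .
  have "form_norm (2 * n) (wedge n n \<alpha> \<alpha>) / 2 ^ n = s / 2 ^ n * wedge n n \<alpha> \<alpha> ?e"
    using form_norm_top[of "wedge n n \<alpha> \<alpha>"] top unfolding dim by (simp add: s_def)
  also have "\<dots> = wedge n n \<alpha> \<alpha> x"
    unfolding x_def multilinear_forms_scale[OF top] prod_c ..
  \<comment> \<open>On diagonal vectors \<open>fst\<close> and \<open>snd\<close> both return
    \<open>x i\<close>, so the two wedge products agree term by term.\<close>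
  also have "\<dots> = ?\<Omega> (\<lambda>i. (x i, x i))"
    by (simp add: wedge_def Alt_def tensor_def pullback_def)
  also have "\<dots> \<le> comass (2 * n) ?\<Omega>"
  proof (rule comass_ge_orthonormal[OF \<Omega>])
    fix i j assume "i < 2 * n" "j < 2 * n"
    then have "?e i \<bullet> ?e j = (if i = j then 1 else 0)"
      using basis_enum_inner[where 'a = "real ^ 'm"] unfolding dim by blast
    \<comment> \<open>The two components contribute equally, giving
      \<open>2 * (c j * c j) = 1\<close> when \<open>i = j\<close>; the sign \<open>s\<close>
      disappears in the square.\<close>
    then show "(x i, x i) \<bullet> (x j, x j) = (if i = j then 1 else 0)"
      using c2[of j] by (simp add: x_def)
  qed
  finally show ?thesis .
qed

end
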